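(* Let $Br(B_n)$ be the generalized braid group (Artin group) of type $B_n$, with canonical generators $\sigma_1,\dots,\sigma_{n-1},\tau$. Put $\sigma=\sigma_1\sigma_2\cdots\sigma_{n-1}$. Then $Br(B_n)$ has a presentation with three generators $\sigma_1,\sigma,\tau$ and relations $$\begin{cases} \sigma_1\sigma^i\sigma_1\sigma^{-i}=\sigma^i\sigma_1\sigma^{-i}\sigma_1 & \text{for } 2\le i\le n/2,\\ \sigma^n=(\sigma\sigma_1)^{n-1},\\ \tau\sigma^i\sigma_1\sigma^{-i}=\sigma^i\sigma_1\sigma^{-i}\tau & \text{for } 2\le i\le n-2,\\ \tau\sigma_1\tau\sigma_1=\sigma_1\tau\sigma_1\tau. \end{cases}$$ Moreover, adding the relations $\sigma_1^2=1$ and $\tau^2=1$ to these gives a presentation of the Coxeter group of type $B_n$.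
   Context: The braid group of type $B_n$ is the group with generators $\sigma_i$, $i=1,\dots,n-1$, and $\tau$, and relations: $\sigma_i\sigma_j=\sigma_j\sigma_i$ if $|i-j|>1$; $\sigma_i\sigma_{i+1}\sigma_i=\sigma_{i+1}\sigma_i\sigma_{i+1}$; $\tau\sigma_i=\sigma_i\tau$ if $i\ge 2$; $\tau\sigma_1\tau\sigma_1=\sigma_1\tau\sigma_1\tau$. The Coxeter group of type $B_n$ is its quotient by the additional relations that the squares of all canonical generators $\sigma_1,\dots,\sigma_{n-1},\tau$ are trivial.
   Formalization: The third family is taken for 1≤i≤n−2; printed from i=2 it omits that τ commutes with σ_2, and the claim fails for n≥3 (in S_n send σ_k to (k k+1) and τ to (1 2): all printed relations hold, but (1 2), (2 3) do not commute). n≥2 is assumed so that σ_1 exists. *)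

theory Defs
  imports "HOL-Algebra.Group"
begin

section \<open>Groups given by generators and relations\<close>

text \<open>The letter \<open>(x, True)\<close> stands for the generator \<open>x\<close>, the letter \<open>(x, False)\<close> for its
  formal inverse. A relation is a pair \<open>(u, v)\<close> of words, standing for the equation \<open>u = v\<close>.\<close>

type_synonym 'a word = "('a \<times> bool) list"

definition words :: "'a set \<Rightarrow> 'a word set" where
  "words X = lists (X \<times> UNIV)"

definition gen :: "'a \<Rightarrow> 'a word" where
  "gen x = [(x, True)]"

definition winv :: "'a word \<Rightarrow> 'a word" where
  "winv w = rev (map (\<lambda>(x, b). (x, \<not> b)) w)"

definition wpow :: "'a word \<Rightarrow> nat \<Rightarrow> 'a word" where
  "wpow w k = concat (replicate k w)"

inductive_set pres_rel :: "'a set \<Rightarrow> ('a word \<times> 'a word) set \<Rightarrow> ('a word \<times> 'a word) set"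
  for X :: "'a set" and R :: "('a word \<times> 'a word) set" where
  refl: "w \<in> words X \<Longrightarrow> (w, w) \<in> pres_rel X R"
| sym: "(u, v) \<in> pres_rel X R \<Longrightarrow> (v, u) \<in> pres_rel X R"
| trans: "(u, v) \<in> pres_rel X R \<Longrightarrow> (v, w) \<in> pres_rel X R \<Longrightarrow> (u, w) \<in> pres_rel X R"
| append: "(u, v) \<in> pres_rel X R \<Longrightarrow> (u', v') \<in> pres_rel X R \<Longrightarrow> (u @ u', v @ v') \<in> pres_rel X R"
| cancel: "x \<in> X \<Longrightarrow> ([(x, b), (x, \<not> b)], []) \<in> pres_rel X R"
| relation: "(u, v) \<in> R \<Longrightarrow> u \<in> words X \<Longrightarrow> v \<in> words X \<Longrightarrow> (u, v) \<in> pres_rel X R"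

definition wclass :: "'a set \<Rightarrow> ('a word \<times> 'a word) set \<Rightarrow> 'a word \<Rightarrow> 'a word set" where
  "wclass X R w = pres_rel X R `` {w}"

definition presented_group :: "'a set \<Rightarrow> ('a word \<times> 'a word) set \<Rightarrow> 'a word set monoid" where
  "presented_group X R =
     \<lparr>carrier = words X // pres_rel X R,
      mult = (\<lambda>A B. \<Union>u\<in>A. \<Union>v\<in>B. wclass X R (u @ v)),
      one = wclass X R []\<rparr>"

text \<open>\<open>G\<close> is presented by generators \<open>X\<close> and relations \<open>R\<close>, where the generator \<open>x\<close> denotes
  the element \<open>f x\<close> of \<open>G\<close>.\<close>

definition has_presentation ::
  "('g, 'm) monoid_scheme \<Rightarrow> 'a set \<Rightarrow> ('a word \<times> 'a word) set \<Rightarrow> ('a \<Rightarrow> 'g) \<Rightarrow> bool" where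
  "has_presentation G X R f \<longleftrightarrow>
     (\<exists>\<phi> \<in> iso (presented_group X R) G. \<forall>x\<in>X. \<phi> (wclass X R (gen x)) = f x)"

lemma pres_rel_words:
  assumes "(u, v) \<in> pres_rel X R"
  shows "u \<in> words X" "v \<in> words X"
  using assms by (induction rule: pres_rel.induct) (auto simp: words_def)

lemma equiv_pres_rel: "equiv (words X) (pres_rel X R)"
proof (rule equivI)
  show "pres_rel X R \<subseteq> words X \<times> words X"
    by (auto dest: pres_rel_words)
  show "refl_on (words X) (pres_rel X R)"
    by (auto simp: refl_on_def intro: pres_rel.refl)
  show "Relation.sym (pres_rel X R)"
    by (auto simp: sym_def intro: pres_rel.sym)
  show "Relation.trans (pres_rel X R)"
    unfolding trans_def by (blast intro: pres_rel.trans)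
qed

lemma mult_presented_group:
  assumes "u \<in> words X" "v \<in> words X"
  shows "wclass X R u \<otimes>\<^bsub>presented_group X R\<^esub> wclass X R v = wclass X R (u @ v)"
proof -
  have *: "wclass X R (u' @ v') = wclass X R (u @ v)"
    if "u' \<in> wclass X R u" "v' \<in> wclass X R v" for u' v'
  proof -
    have "(u @ v, u' @ v') \<in> pres_rel X R"
      using that by (auto simp: wclass_def intro: pres_rel.append)
    then show ?thesis
      unfolding wclass_def using equiv_class_eq[OF equiv_pres_rel] by fastforce
  qed
  have "u \<in> wclass X R u" "v \<in> wclass X R v"
    using assms by (auto simp: wclass_def intro: pres_rel.refl)
  then have "(\<Union>u'\<in>wclass X R u. \<Union>v'\<in>wclass X R v. wclass X R (u' @ v')) = wclass X R (u @ v)"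
    using * by blast
  then show ?thesis
    by (simp add: presented_group_def)
qed

lemma winv_cancel:
  assumes "w \<in> words X"
  shows "(winv w @ w, []) \<in> pres_rel X R"
  using assms
proof (induction w)
  case Nil
  then show ?case
    by (simp add: winv_def words_def pres_rel.refl)
next
  case (Cons a w)
  obtain x b where a: "a = (x, b)" by (cases a)
  have w: "w \<in> words X" "x \<in> X" "winv w \<in> words X"
    using Cons.prems by (auto simp: words_def a winv_def)
  have "([(x, \<not> b), (x, b)], []) \<in> pres_rel X R"
    using pres_rel.cancel[OF w(2), of "\<not> b"] by simp
  then have "([(x, \<not> b), (x, b)] @ w, [] @ w) \<in> pres_rel X R"
    using w pres_rel.append pres_rel.refl by blast
  then have "(winv w @ [(x, \<not> b), (x, b)] @ w, winv w @ [] @ w) \<in> pres_rel X R"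
    using w pres_rel.append pres_rel.refl by blast
  moreover have "winv (a # w) @ a # w = winv w @ [(x, \<not> b), (x, b)] @ w"
    by (simp add: winv_def a)
  ultimately show ?case
    using Cons.IH w pres_rel.trans by fastforce
qed

lemma group_presented_group: "group (presented_group X R)"
proof (rule groupI)
  let ?G = "presented_group X R"
  have carrier: "carrier ?G = wclass X R ` words X"
    by (auto simp: presented_group_def quotient_def wclass_def)
  have nil: "[] \<in> words X" by (simp add: words_def)
  have app: "u @ v \<in> words X" if "u \<in> words X" "v \<in> words X" for u v
    using that by (simp add: words_def)
  have one: "\<one>\<^bsub>?G\<^esub> = wclass X R []" by (simp add: presented_group_def)
  show "\<one>\<^bsub>?G\<^esub> \<in> carrier ?G" using one carrier nil by blast
  show "a \<otimes>\<^bsub>?G\<^esub> b \<in> carrier ?G" if "a \<in> carrier ?G" "b \<in> carrier ?G" for a b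
    using that by (auto simp: carrier mult_presented_group app)
  show "a \<otimes>\<^bsub>?G\<^esub> b \<otimes>\<^bsub>?G\<^esub> c = a \<otimes>\<^bsub>?G\<^esub> (b \<otimes>\<^bsub>?G\<^esub> c)"
    if "a \<in> carrier ?G" "b \<in> carrier ?G" "c \<in> carrier ?G" for a b c
    using that by (auto simp: carrier mult_presented_group app)
  show "\<one>\<^bsub>?G\<^esub> \<otimes>\<^bsub>?G\<^esub> a = a" if "a \<in> carrier ?G" for a
    using that by (auto simp: carrier one mult_presented_group nil)
  show "\<exists>b\<in>carrier ?G. b \<otimes>\<^bsub>?G\<^esub> a = \<one>\<^bsub>?G\<^esub>" if a: "a \<in> carrier ?G" for a
  proof -
    obtain w where w: "w \<in> words X" "a = wclass X R w"
      using a carrier by auto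
    have i: "winv w \<in> words X"
      using w(1) by (auto simp: words_def winv_def)
    have "wclass X R (winv w) \<otimes>\<^bsub>?G\<^esub> a = wclass X R (winv w @ w)"
      using w i by (simp add: mult_presented_group)
    also have "\<dots> = \<one>\<^bsub>?G\<^esub>"
      unfolding one wclass_def
      using equiv_class_eq[OF equiv_pres_rel winv_cancel[OF w(1)]] .
    finally show ?thesis using i carrier by blast
  qed
qed

section \<open>The braid group and the Coxeter group of type B\<close>

datatype B_gen = Sigma_gen nat | Tau_gen

definition B_gens :: "nat \<Rightarrow> B_gen set" where
  "B_gens n = Sigma_gen ` {1..n - 1} \<union> {Tau_gen}"

definition B_rels :: "nat \<Rightarrow> (B_gen word \<times> B_gen word) set" where
  "B_rels n = (let \<sigma> = (\<lambda>i. gen (Sigma_gen i)); \<tau> = gen Tau_gen in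
     {(\<sigma> i @ \<sigma> j, \<sigma> j @ \<sigma> i) | i j.
        i \<in> {1..n - 1} \<and> j \<in> {1..n - 1} \<and> \<bar>int i - int j\<bar> > 1}
   \<union> {(\<sigma> i @ \<sigma> (i + 1) @ \<sigma> i, \<sigma> (i + 1) @ \<sigma> i @ \<sigma> (i + 1)) | i. 1 \<le> i \<and> i + 1 \<le> n - 1}
   \<union> {(\<tau> @ \<sigma> i, \<sigma> i @ \<tau>) | i. 2 \<le> i \<and> i \<le> n - 1}
   \<union> {(\<tau> @ \<sigma> 1 @ \<tau> @ \<sigma> 1, \<sigma> 1 @ \<tau> @ \<sigma> 1 @ \<tau>)})"

definition B_square_rels :: "nat \<Rightarrow> (B_gen word \<times> B_gen word) set" where
  "B_square_rels n = {(gen x @ gen x, []) | x. x \<in> B_gens n}"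

definition Br_B :: "nat \<Rightarrow> B_gen word set monoid" where
  "Br_B n = presented_group (B_gens n) (B_rels n)"

definition Coxeter_B :: "nat \<Rightarrow> B_gen word set monoid" where
  "Coxeter_B n = presented_group (B_gens n) (B_rels n \<union> B_square_rels n)"

definition sigma_word :: "nat \<Rightarrow> B_gen word" where
  "sigma_word n = concat (map (\<lambda>i. gen (Sigma_gen i)) [1..<n])"

section \<open>The presentation with three generators\<close>

datatype gen3 = S1 | S | T

text \<open>In the third family the exponent \<open>i\<close> starts at 1, not at 2 as in the printed source.
  The word \<open>\<sigma>\<^sup>i \<sigma>\<^sub>1 \<sigma>\<^sup>-\<^sup>i\<close> represents \<open>\<sigma>\<^sub>i\<^sub>+\<^sub>1\<close>, so the family expresses that \<open>\<tau>\<close> commutes with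
  \<open>\<sigma>\<^sub>2, \<dots>, \<sigma>\<^sub>n\<^sub>-\<^sub>1\<close>. The case \<open>i = 1\<close> does not follow from the other relations: for \<open>n \<ge> 3\<close>,
  sending \<open>\<sigma>\<^sub>k\<close> to the transposition \<open>(k k+1)\<close> and \<open>\<tau>\<close> to \<open>(1 2)\<close> satisfies all of them
  (and the square relations), but \<open>(1 2)\<close> does not commute with \<open>(2 3)\<close>.\<close>

definition few_rels :: "nat \<Rightarrow> (gen3 word \<times> gen3 word) set" where
  "few_rels n = (let \<sigma>\<^sub>1 = gen S1; \<sigma> = gen S; \<tau> = gen T;
       s = (\<lambda>i. wpow \<sigma> i @ \<sigma>\<^sub>1 @ wpow (winv \<sigma>) i) in
     {(\<sigma>\<^sub>1 @ s i, s i @ \<sigma>\<^sub>1) | i. 2 \<le> i \<and> 2 * i \<le> n}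
   \<union> {(wpow \<sigma> n, wpow (\<sigma> @ \<sigma>\<^sub>1) (n - 1))}
   \<union> {(\<tau> @ s i, s i @ \<tau>) | i. 1 \<le> i \<and> i \<le> n - 2}
   \<union> {(\<tau> @ \<sigma>\<^sub>1 @ \<tau> @ \<sigma>\<^sub>1, \<sigma>\<^sub>1 @ \<tau> @ \<sigma>\<^sub>1 @ \<tau>)})"

definition few_square_rels :: "(gen3 word \<times> gen3 word) set" where
  "few_square_rels = {(gen S1 @ gen S1, []), (gen T @ gen T, [])}"

primrec gen3_word :: "nat \<Rightarrow> gen3 \<Rightarrow> B_gen word" where
  "gen3_word n S1 = gen (Sigma_gen 1)"
| "gen3_word n S = sigma_word n"
| "gen3_word n T = gen Tau_gen"

end

theory Submission
  imports Defs
begin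

text \<open>Put \<open>x\<^sub>i = \<sigma>\<^sup>i \<sigma>\<^sub>1 \<sigma>\<^sup>-\<^sup>i\<close>, so that \<open>x\<^sub>i\<close> should be \<open>\<sigma>\<^sub>i\<^sub>+\<^sub>1\<close>. Since
  \<open>(\<sigma> \<sigma>\<^sub>1)\<^sup>m = x\<^sub>1 \<dots> x\<^sub>m \<sigma>\<^sup>m\<close>, the relation \<open>\<sigma>\<^sup>n = (\<sigma> \<sigma>\<^sub>1)\<^sup>n\<^sup>-\<^sup>1\<close> says exactly, after conjugation by
  \<open>\<sigma>\<close>, that \<open>\<sigma> = x\<^sub>0 \<dots> x\<^sub>n\<^sub>-\<^sub>2\<close>. It also makes \<open>\<sigma>\<^sup>n\<close> commute with \<open>\<sigma>\<close> and \<open>\<sigma> \<sigma>\<^sub>1\<close>, hence \<open>x\<^sub>i\<close>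
  is periodic in \<open>i\<close> with period \<open>n\<close>, and the commutation of \<open>x\<^sub>0\<close> with \<open>x\<^sub>i\<close> for \<open>2 \<le> i \<le> n/2\<close> extends
  to \<open>2 \<le> i \<le> n - 2\<close> by conjugating with a power of \<open>\<sigma>\<close>. The braid relation for \<open>x\<^sub>0, x\<^sub>1\<close> is then
  \<open>\<sigma> x\<^sub>0 = x\<^sub>1 \<sigma>\<close> with the product inserted for \<open>\<sigma>\<close>. All \<open>\<sigma>\<^sub>i\<close> are conjugate, so
  \<open>\<sigma>\<^sub>1\<^sup>2 = 1\<close> suffices for the squares.\<close>

section \<open>Evaluating words in a group\<close>

lemma words_simps [simp]:
  "[] \<in> words X"
  "u @ v \<in> words X \<longleftrightarrow> u \<in> words X \<and> v \<in> words X"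
  "(x, b) # w \<in> words X \<longleftrightarrow> x \<in> X \<and> w \<in> words X"
  "gen x \<in> words X \<longleftrightarrow> x \<in> X"
  by (auto simp: words_def gen_def)

lemma winv_in_words [simp]: "w \<in> words X \<Longrightarrow> winv w \<in> words X"
  by (auto simp: words_def winv_def)

lemma wpow_simps [simp]: "wpow w 0 = []" "wpow w (Suc k) = w @ wpow w k"
  by (simp_all add: wpow_def)

lemma wpow_in_words [simp]: "w \<in> words X \<Longrightarrow> wpow w k \<in> words X"
  by (induction k) auto

text \<open>Defined on raw words rather than on classes, so that values can be compared before any
  relation is known to hold.\<close>

definition eval_word :: "('g, 'm) monoid_scheme \<Rightarrow> ('a \<Rightarrow> 'g) \<Rightarrow> 'a word \<Rightarrow> 'g" where
  "eval_word G f w = foldr (\<lambda>(x, b) a. (if b then f x else inv\<^bsub>G\<^esub> f x) \<otimes>\<^bsub>G\<^esub> a) w \<one>\<^bsub>G\<^esub>"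

definition satisfies :: "('g, 'm) monoid_scheme \<Rightarrow> ('a \<Rightarrow> 'g) \<Rightarrow> ('a word \<times> 'a word) set \<Rightarrow> bool" where
  "satisfies G f R \<longleftrightarrow> (\<forall>(u, v)\<in>R. eval_word G f u = eval_word G f v)"

lemma satisfies_Un: "satisfies G f (R \<union> R') \<longleftrightarrow> satisfies G f R \<and> satisfies G f R'"
  by (auto simp: satisfies_def)

lemma satisfies_Collect:
  "satisfies G f {(u i, v i) | i. P i} \<longleftrightarrow>
    (\<forall>i. P i \<longrightarrow> eval_word G f (u i) = eval_word G f (v i))"
  "satisfies G f {(u' i j, v' i j) | i j. P' i j} \<longleftrightarrow>
    (\<forall>i j. P' i j \<longrightarrow> eval_word G f (u' i j) = eval_word G f (v' i j))"
  "satisfies G f {(w, w')} \<longleftrightarrow> eval_word G f w = eval_word G f w'"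
  by (auto simp: satisfies_def)

lemma eval_word_simps [simp]:
  "eval_word G f [] = \<one>\<^bsub>G\<^esub>"
  "eval_word G f ((x, b) # w) = (if b then f x else inv\<^bsub>G\<^esub> f x) \<otimes>\<^bsub>G\<^esub> eval_word G f w"
  by (simp_all add: eval_word_def)

context group
begin

lemma eval_word_closed [simp]:
  assumes "f \<in> X \<rightarrow> carrier G" "w \<in> words X"
  shows "eval_word G f w \<in> carrier G"
  using assms(2)
proof (induction w)
  case (Cons l w)
  then show ?case using assms(1) by (cases l) auto
qed simp

lemma eval_word_append:
  assumes "f \<in> X \<rightarrow> carrier G" "u \<in> words X" "v \<in> words X"
  shows "eval_word G f (u @ v) = eval_word G f u \<otimes> eval_word G f v"
  using assms(2)
proof (induction u)
  case Nil
  then show ?case using assms by simp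
next
  case (Cons l u)
  have "eval_word G f u \<in> carrier G" "eval_word G f v \<in> carrier G"
    using Cons.prems assms by (cases l, auto)+
  then show ?case using Cons assms(1) by (cases l) (auto simp: m_assoc Pi_iff)
qed

lemma eval_word_gen:
  assumes "f \<in> X \<rightarrow> carrier G" "x \<in> X"
  shows "eval_word G f (gen x) = f x"
  using assms by (auto simp: gen_def Pi_iff)

text \<open>\<open>pres_rel\<close> is the least congruence containing the relations and the free
  cancellations, and evaluation respects each closure rule; \<open>satisfies\<close> enters only in
  the case \<open>relation\<close>.\<close>

lemma eval_word_pres_rel:
  assumes f: "f \<in> X \<rightarrow> carrier G" and R: "satisfies G f R" and uv: "(u, v) \<in> pres_rel X R"
  shows "eval_word G f u = eval_word G f v"
  using uv
proof induction
  case (append u v u' v')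
  then show ?case using f by (simp add: eval_word_append pres_rel_words)
next
  case (cancel x b)
  then have "f x \<in> carrier G" using f by auto
  then show ?case by (cases b) auto
next
  case (relation u v)
  then show ?case using R by (auto simp: satisfies_def)
qed auto

lemma eval_word_winv:
  assumes f: "f \<in> X \<rightarrow> carrier G" and w: "w \<in> words X"
  shows "eval_word G f (winv w) = inv (eval_word G f w)"
proof -
  \<comment> \<open>With the empty set of relations \<open>satisfies\<close> is vacuous, so
    cancellation in the free group already identifies the inverse.\<close>
  have "eval_word G f (winv w @ w) = eval_word G f []"
    by (rule eval_word_pres_rel[OF f _ winv_cancel[OF w, of "{}"]]) (simp add: satisfies_def)
  then show ?thesis using f w by (simp add: eval_word_append inv_equality)
qed

lemma eval_word_wpow:
  assumes "f \<in> X \<rightarrow> carrier G" "w \<in> words X"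
  shows "eval_word G f (wpow w k) = eval_word G f w [^] k"
proof (induction k)
  case (Suc k)
  have "eval_word G f (wpow w (Suc k)) = eval_word G f w \<otimes> eval_word G f w [^] k"
    using assms Suc by (simp add: eval_word_append)
  also have "\<dots> = eval_word G f w [^] Suc k"
    using nat_pow_Suc2[OF eval_word_closed[OF assms]] by simp
  finally show ?case .
qed simp

end

lemma eval_word_hom:
  assumes h: "h \<in> hom G H" and G: "group G" and H: "group H"
    and f: "f \<in> X \<rightarrow> carrier G" and w: "w \<in> words X"
  shows "h (eval_word G f w) = eval_word H (\<lambda>x. h (f x)) w"
  using w
proof (induction w)
  interpret group_hom G H h
    using h G H by (simp add: group_hom_def group_hom_axioms_def)
  case Nil
  show ?case by simp
next
  interpret group_hom G H h
    using h G H by (simp add: group_hom_def group_hom_axioms_def)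
  case (Cons l w)
  have "eval_word G f w \<in> carrier G"
    using Cons.prems f by (cases l) auto
  then show ?case using Cons f by (cases l) (auto simp: Pi_iff)
qed

lemma eval_word_cong:
  assumes "\<And>x. x \<in> X \<Longrightarrow> f x = g x" "w \<in> words X"
  shows "eval_word G f w = eval_word G g w"
  using assms(2)
proof (induction w)
  case (Cons l w)
  then show ?case using assms(1) by (cases l) auto
qed simp

section \<open>Homomorphisms out of a presented group\<close>

lemma carrier_presented_group: "carrier (presented_group X R) = wclass X R ` words X"
  by (auto simp: presented_group_def quotient_def wclass_def)

lemma eval_word_presented_group:
  assumes "w \<in> words X"
  shows "eval_word (presented_group X R) (\<lambda>x. wclass X R (gen x)) w = wclass X R w"
  using assms
proof (induction w)
  case Nil
  then show ?case by (simp add: presented_group_def)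
next
  case (Cons l w)
  interpret group "presented_group X R" by (rule group_presented_group)
  obtain x b where l: "l = (x, b)" by (cases l)
  have x: "x \<in> X" "w \<in> words X" using Cons.prems by (auto simp: l)
  have "(winv (gen x) @ gen x, []) \<in> pres_rel X R"
    using x by (intro winv_cancel) simp
  then have "wclass X R (winv (gen x) @ gen x) = wclass X R []"
    unfolding wclass_def using equiv_class_eq[OF equiv_pres_rel] by fastforce
  then have "inv\<^bsub>presented_group X R\<^esub> wclass X R (gen x) = wclass X R (winv (gen x))"
  proof (intro inv_equality)
    show "wclass X R (winv (gen x)) \<otimes>\<^bsub>presented_group X R\<^esub> wclass X R (gen x) = \<one>\<^bsub>presented_group X R\<^esub>"
      if "wclass X R (winv (gen x) @ gen x) = wclass X R []"
      using that x by (subst mult_presented_group) (simp_all add: presented_group_def)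
  qed (use x in \<open>simp_all add: carrier_presented_group\<close>)
  moreover have "gen x @ w = (x, True) # w" "winv (gen x) @ w = (x, False) # w"
    by (simp_all add: gen_def winv_def)
  ultimately show ?case
    using Cons.IH x mult_presented_group[of "gen x" X w R]
      mult_presented_group[of "winv (gen x)" X w R]
    by (cases b) (simp_all only: l eval_word_simps if_True if_False words_simps winv_in_words)
qed

text \<open>A pair of \<open>R\<close> enters \<open>pres_rel\<close> only if both its sides are
  words over \<open>X\<close>, hence the assumption.\<close>

lemma satisfies_presented_group:
  assumes "R \<subseteq> words X \<times> words X"
  shows "satisfies (presented_group X R) (\<lambda>x. wclass X R (gen x)) R"
proof -
  have "wclass X R u = wclass X R v" if "(u, v) \<in> R" for u v
    unfolding wclass_def
    using that assms by (intro equiv_class_eq[OF equiv_pres_rel] pres_rel.relation) auto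
  then show ?thesis
    using assms unfolding satisfies_def by (auto simp: eval_word_presented_group subset_iff)
qed

text \<open>Von Dyck's theorem, the universal property of a presentation.\<close>

lemma induced_hom:
  assumes "group G" and f: "f \<in> X \<rightarrow> carrier G" and R: "satisfies G f R"
  obtains \<phi> where "\<phi> \<in> hom (presented_group X R) G"
    "\<And>w. w \<in> words X \<Longrightarrow> \<phi> (wclass X R w) = eval_word G f w"
proof -
  interpret group G by fact
  \<comment> \<open>Evaluation is constant on each class, so its image of a class is a
    singleton.\<close>
  define \<phi> where "\<phi> A = the_elem (eval_word G f ` A)" for A
  have \<phi>: "\<phi> (wclass X R w) = eval_word G f w" if "w \<in> words X" for w
  proof -
    have "w \<in> wclass X R w" using that by (auto simp: wclass_def intro: pres_rel.refl)
    moreover have "eval_word G f v = eval_word G f w" if "v \<in> wclass X R w" for v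
      using eval_word_pres_rel[OF f R, of w v] that by (simp add: wclass_def)
    ultimately have "eval_word G f ` wclass X R w = {eval_word G f w}" by blast
    then show ?thesis by (simp add: \<phi>_def)
  qed
  have "\<phi> \<in> hom (presented_group X R) G"
    using f by (intro homI)
      (auto simp: carrier_presented_group \<phi> mult_presented_group eval_word_append)
  with \<phi> show ?thesis by (rule that[rotated])
qed

text \<open>Von Dyck's theorem gives homomorphisms in both directions from \<open>sat_R\<close> and
  \<open>sat_Q\<close>; by \<open>hg\<close> and \<open>gh\<close> their composites fix the
  generators, so they are mutually inverse.\<close>

lemma has_presentation_change_generators:
  assumes R: "R \<subseteq> words X \<times> words X" and Q: "Q \<subseteq> words Y \<times> words Y"
    and g: "\<And>x. x \<in> X \<Longrightarrow> g x \<in> words Y" and h: "\<And>y. y \<in> Y \<Longrightarrow> h y \<in> words X"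
    and sat_R: "satisfies (presented_group Y Q) (\<lambda>x. wclass Y Q (g x)) R"
    and sat_Q: "satisfies (presented_group X R) (\<lambda>y. wclass X R (h y)) Q"
    and hg: "\<And>x. x \<in> X \<Longrightarrow>
      eval_word (presented_group X R) (\<lambda>y. wclass X R (h y)) (g x) = wclass X R (gen x)"
    and gh: "\<And>y. y \<in> Y \<Longrightarrow>
      eval_word (presented_group Y Q) (\<lambda>x. wclass Y Q (g x)) (h y) = wclass Y Q (gen y)"
  shows "has_presentation (presented_group Y Q) X R (\<lambda>x. wclass Y Q (g x))"
proof -
  let ?G = "presented_group Y Q" and ?H = "presented_group X R"
  interpret G: group ?G by (rule group_presented_group)
  interpret H: group ?H by (rule group_presented_group)
  have f: "(\<lambda>x. wclass Y Q (g x)) \<in> X \<rightarrow> carrier ?G"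
    and k: "(\<lambda>y. wclass X R (h y)) \<in> Y \<rightarrow> carrier ?H"
    using g h by (auto simp: carrier_presented_group)
  obtain \<phi> where \<phi>: "\<phi> \<in> hom ?H ?G"
    "\<And>w. w \<in> words X \<Longrightarrow> \<phi> (wclass X R w) = eval_word ?G (\<lambda>x. wclass Y Q (g x)) w"
    using induced_hom[OF group_presented_group f sat_R] by blast
  obtain \<psi> where \<psi>: "\<psi> \<in> hom ?G ?H"
    "\<And>w. w \<in> words Y \<Longrightarrow> \<psi> (wclass Y Q w) = eval_word ?H (\<lambda>y. wclass X R (h y)) w"
    using induced_hom[OF group_presented_group k sat_Q] by blast
  have \<psi>\<phi>: "\<psi> (\<phi> A) = A" if A: "A \<in> carrier ?H" for A
  proof -
    obtain w where w: "w \<in> words X" "A = wclass X R w"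
      using A by (auto simp: carrier_presented_group)
    have "\<psi> (\<phi> A) = eval_word ?H (\<lambda>x. \<psi> (wclass Y Q (g x))) w"
      using w \<phi>(2) eval_word_hom[OF \<psi>(1) G.is_group H.is_group f] by simp
    also have "\<dots> = eval_word ?H (\<lambda>x. wclass X R (gen x)) w"
      using w by (intro eval_word_cong[where X = X]) (simp_all add: \<psi>(2) g hg)
    finally show ?thesis using w by (simp add: eval_word_presented_group)
  qed
  have \<phi>\<psi>: "\<phi> (\<psi> A) = A" if A: "A \<in> carrier ?G" for A
  proof -
    obtain w where w: "w \<in> words Y" "A = wclass Y Q w"
      using A by (auto simp: carrier_presented_group)
    have "\<phi> (\<psi> A) = eval_word ?G (\<lambda>y. \<phi> (wclass X R (h y))) w"
      using w \<psi>(2) eval_word_hom[OF \<phi>(1) H.is_group G.is_group k] by simp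
    also have "\<dots> = eval_word ?G (\<lambda>y. wclass Y Q (gen y)) w"
      using w by (intro eval_word_cong[where X = Y]) (simp_all add: \<phi>(2) h gh)
    finally show ?thesis using w by (simp add: eval_word_presented_group)
  qed
  have "bij_betw \<phi> (carrier ?H) (carrier ?G)"
    using \<phi>(1) \<psi>(1) \<psi>\<phi> \<phi>\<psi> by (intro bij_betwI[where g = \<psi>]) (auto simp: hom_def)
  then have "\<phi> \<in> iso ?H ?G" using \<phi>(1) by (simp add: iso_def)
  moreover have "\<phi> (wclass X R (gen x)) = wclass Y Q (g x)" if "x \<in> X" for x
    using that f \<phi>(2) by (simp add: G.eval_word_gen[OF f])
  ultimately show ?thesis unfolding has_presentation_def by blast
qed

section \<open>Products of conjugates\<close>

context group
begin

text \<open>With \<open>x i\<close> the value of \<open>\<sigma>\<^sub>i\<^sub>+\<^sub>1\<close> and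
  \<open>m = n - 1\<close> this is \<open>\<sigma>\<close>.\<close>

primrec run :: "(nat \<Rightarrow> 'a) \<Rightarrow> nat \<Rightarrow> 'a" where
  "run x 0 = \<one>"
| "run x (Suc m) = run x m \<otimes> x m"

lemma run_closed [simp]: "(\<And>i. i < m \<Longrightarrow> x i \<in> carrier G) \<Longrightarrow> run x m \<in> carrier G"
  by (induction m) auto

lemma run_cong: "(\<And>i. i < m \<Longrightarrow> x i = y i) \<Longrightarrow> run x m = run y m"
  by (induction m) auto

lemma run_Suc_left:
  "(\<And>i. i \<le> m \<Longrightarrow> x i \<in> carrier G) \<Longrightarrow> run x (Suc m) = x 0 \<otimes> run (\<lambda>i. x (Suc i)) m"
  by (induction m) (auto simp: m_assoc)

lemma commute_run:
  assumes "\<And>i. i < m \<Longrightarrow> x i \<in> carrier G" "a \<in> carrier G" "\<And>i. i < m \<Longrightarrow> a \<otimes> x i = x i \<otimes> a"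
  shows "a \<otimes> run x m = run x m \<otimes> a"
  using assms
proof (induction m)
  case (Suc m)
  have "a \<otimes> run x (Suc m) = (a \<otimes> run x m) \<otimes> x m" using Suc.prems by (simp add: m_assoc)
  also have "\<dots> = run x m \<otimes> (a \<otimes> x m)" using Suc by (simp add: m_assoc)
  also have "\<dots> = run x (Suc m) \<otimes> a" using Suc.prems by (simp add: m_assoc)
  finally show ?case .
qed simp

text \<open>This is how \<open>\<sigma>\<close> conjugates \<open>\<sigma>\<^sub>i\<close> to \<open>\<sigma>\<^sub>i\<^sub>+\<^sub>1\<close>, with indices starting at 0.\<close>

lemma run_braid_shift:
  assumes y: "\<And>i. i < m \<Longrightarrow> y i \<in> carrier G"
    and comm: "\<And>i j. i + 1 < j \<Longrightarrow> j < m \<Longrightarrow> y i \<otimes> y j = y j \<otimes> y i"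
    and braid: "\<And>i. i + 1 < m \<Longrightarrow> y i \<otimes> y (i + 1) \<otimes> y i = y (i + 1) \<otimes> y i \<otimes> y (i + 1)"
    and i: "i + 1 < m"
  shows "run y m \<otimes> y i = y (i + 1) \<otimes> run y m"
proof -
  \<comment> \<open>Induction on the length of the product: the braid relation acts when the last
    factor is \<open>y (i + 1)\<close>, and every later factor commutes with
    \<open>y i\<close>.\<close>
  have "run y k \<otimes> y i = y (i + 1) \<otimes> run y k" if "i + 2 \<le> k" "k \<le> m" for k
    using that
  proof (induction k rule: dec_induct)
    case base
    have *: "y (i + 1) \<otimes> run y i = run y i \<otimes> y (i + 1)"
      using i by (intro commute_run) (auto simp: y simp flip: comm)
    have "run y (i + 2) \<otimes> y i = run y i \<otimes> (y i \<otimes> y (i + 1) \<otimes> y i)"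
      using i by (simp add: y m_assoc)
    also have "\<dots> = (run y i \<otimes> y (i + 1)) \<otimes> (y i \<otimes> y (i + 1))"
      using i by (subst braid) (simp_all add: y m_assoc)
    also have "\<dots> = (y (i + 1) \<otimes> run y i) \<otimes> (y i \<otimes> y (i + 1))"
      by (simp only: *)
    also have "\<dots> = y (i + 1) \<otimes> run y (i + 2)"
      using i by (simp add: y m_assoc)
    finally show ?case .
  next
    case (step k)
    have "run y (Suc k) \<otimes> y i = run y k \<otimes> (y k \<otimes> y i)" using step by (simp add: y m_assoc)
    also have "\<dots> = (run y k \<otimes> y i) \<otimes> y k" 
      using step.hyps step.prems comm[of i k] by (simp add: y m_assoc)
    also have "\<dots> = (y (i + 1) \<otimes> run y k) \<otimes> y k" using step by simp
    also have "\<dots> = y (i + 1) \<otimes> run y (Suc k)" using step by (simp add: y m_assoc)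
    finally show ?case .
  qed
  then show ?thesis using i by simp
qed

definition conj_pow :: "'a \<Rightarrow> 'a \<Rightarrow> nat \<Rightarrow> 'a" where
  "conj_pow c a i = c [^] i \<otimes> a \<otimes> inv (c [^] i)"

lemma conj_pow_closed [simp]: "c \<in> carrier G \<Longrightarrow> a \<in> carrier G \<Longrightarrow> conj_pow c a i \<in> carrier G"
  by (simp add: conj_pow_def)

lemma conj_pow_0 [simp]: "a \<in> carrier G \<Longrightarrow> conj_pow c a 0 = a"
  by (simp add: conj_pow_def)

lemma conj_pow_add:
  assumes "c \<in> carrier G" "a \<in> carrier G"
  shows "conj_pow c a (i + j) = conj_pow c (conj_pow c a j) i"
proof -
  have "c [^] (i + j) = c [^] i \<otimes> c [^] j" using assms by (simp add: nat_pow_mult)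
  then show ?thesis using assms by (simp add: conj_pow_def inv_mult_group m_assoc)
qed

lemma conj_pow_mult:
  assumes "c \<in> carrier G" "a \<in> carrier G" "b \<in> carrier G"
  shows "conj_pow c (a \<otimes> b) i = conj_pow c a i \<otimes> conj_pow c b i"
proof -
  have "inv (c [^] i) \<otimes> (c [^] i \<otimes> z) = z" if "z \<in> carrier G" for z
    using that assms by (simp flip: m_assoc)
  then show ?thesis using assms by (simp add: conj_pow_def m_assoc)
qed

lemma conj_pow_commute:
  assumes "c \<in> carrier G" "a \<in> carrier G"
  shows "c [^] i \<otimes> a = conj_pow c a i \<otimes> c [^] i"
  using assms by (simp add: conj_pow_def m_assoc)

lemma conj_pow_eqI:
  assumes "c \<in> carrier G" "a \<in> carrier G" "b \<in> carrier G" "c [^] i \<otimes> a = b \<otimes> c [^] i"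
  shows "conj_pow c a i = b"
  using assms by (simp add: conj_pow_def m_assoc)

lemma conj_pow_Suc_commute:
  assumes "c \<in> carrier G" "a \<in> carrier G"
  shows "c \<otimes> conj_pow c a i = conj_pow c a (Suc i) \<otimes> c"
  using conj_pow_commute[of c "conj_pow c a i" 1] conj_pow_add[of c a 1 i] assms by simp

text \<open>Moving the accumulated power of \<open>c\<close> past each new \<open>a\<close> turns
  that \<open>a\<close> into a conjugate. The first \<open>a\<close> already has one
  \<open>c\<close> in front, so the indices start at 1.\<close>

lemma pow_mult_eq_run:
  assumes c: "c \<in> carrier G" and a: "a \<in> carrier G"
  shows "(c \<otimes> a) [^] m = run (\<lambda>i. conj_pow c a (Suc i)) m \<otimes> c [^] m"
proof (induction m)
  case (Suc m)
  let ?r = "run (\<lambda>i. conj_pow c a (Suc i)) m"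
  have "(c \<otimes> a) [^] Suc m = ?r \<otimes> (c [^] Suc m \<otimes> a)"
    using Suc assms by (simp add: m_assoc)
  also have "\<dots> = ?r \<otimes> (conj_pow c a (Suc m) \<otimes> c [^] Suc m)"
    using assms by (simp only: conj_pow_commute)
  finally show ?case using assms by (simp add: m_assoc del: nat_pow_Suc)
qed simp

lemma mult_run_conj_pow:
  assumes c: "c \<in> carrier G" and a: "a \<in> carrier G"
  shows "c \<otimes> run (conj_pow c a) m = run (\<lambda>i. conj_pow c a (Suc i)) m \<otimes> c"
proof (induction m)
  case (Suc m)
  have "c \<otimes> run (conj_pow c a) (Suc m) = (c \<otimes> run (conj_pow c a) m) \<otimes> conj_pow c a m"
    using assms by (simp add: m_assoc)
  also have "\<dots> = run (\<lambda>i. conj_pow c a (Suc i)) m \<otimes> (c \<otimes> conj_pow c a m)"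
    unfolding Suc using assms by (simp add: m_assoc)
  also have "\<dots> = run (\<lambda>i. conj_pow c a (Suc i)) m \<otimes> (conj_pow c a (Suc m) \<otimes> c)"
    using assms by (simp only: conj_pow_Suc_commute)
  finally show ?case using assms by (simp add: m_assoc)
qed (use assms in simp)

text \<open>Read from right to left it yields the relation on \<open>\<sigma>\<^sup>n\<close> in the
  braid group; read from left to right it recovers \<open>\<sigma>\<close> from the three-generator
  relations.\<close>

lemma pow_eq_iff_run:
  assumes c: "c \<in> carrier G" and a: "a \<in> carrier G"
  shows "c [^] Suc m = (c \<otimes> a) [^] m \<longleftrightarrow> c = run (conj_pow c a) m"
proof -
  let ?r = "run (\<lambda>i. conj_pow c a (Suc i)) m"
  have "c [^] Suc m = (c \<otimes> a) [^] m \<longleftrightarrow> c \<otimes> c [^] m = ?r \<otimes> c [^] m"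
    using nat_pow_Suc2[OF c, of m] pow_mult_eq_run[OF c a, of m] by simp
  \<comment> \<open>Both equations say \<open>c = ?r\<close>. The factor \<open>c\<close> on the
    right is there so that \<open>mult_run_conj_pow\<close> can lower the indices of
    \<open>?r\<close> by one.\<close>
  also have "\<dots> \<longleftrightarrow> c \<otimes> c = ?r \<otimes> c"
    using assms by simp
  also have "\<dots> \<longleftrightarrow> c = run (conj_pow c a) m"
    using assms by (simp flip: mult_run_conj_pow)
  finally show ?thesis .
qed

section \<open>The relations of the two presentations\<close>

text \<open>Iterates \<open>run_braid_shift\<close>: each conjugation by the product raises the
  index by one while it stays below \<open>m\<close>.\<close>

lemma conj_pow_run_braid:
  assumes y: "\<And>i. i < m \<Longrightarrow> y i \<in> carrier G"
    and comm: "\<And>i j. i + 1 < j \<Longrightarrow> j < m \<Longrightarrow> y i \<otimes> y j = y j \<otimes> y i"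
    and braid: "\<And>i. i + 1 < m \<Longrightarrow> y i \<otimes> y (i + 1) \<otimes> y i = y (i + 1) \<otimes> y i \<otimes> y (i + 1)"
    and i: "i < m"
  shows "conj_pow (run y m) (y 0) i = y i"
  using i
proof (induction i)
  case 0
  then show ?case using y by simp
next
  case (Suc i)
  let ?c = "run y m"
  have "conj_pow ?c (y 0) (1 + i) = conj_pow ?c (y i) 1"
    using Suc y by (subst conj_pow_add) simp_all
  also have "\<dots> = y (Suc i)"
    using Suc.prems y run_braid_shift[of m y i, OF y comm braid]
    by (intro conj_pow_eqI) simp_all
  finally show ?case by simp
qed

text \<open>The element \<open>c [^] n\<close> is a power of \<open>c\<close> and of
  \<open>c \<otimes> a\<close>, so it commutes with both and hence with \<open>a\<close>.\<close>

lemma conj_pow_period: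
  assumes c: "c \<in> carrier G" and a: "a \<in> carrier G" and eq: "c [^] n = (c \<otimes> a) [^] (k :: nat)"
  shows "conj_pow c a n = a"
proof (rule conj_pow_eqI)
  let ?z = "c [^] n"
  have cz: "c \<otimes> ?z = ?z \<otimes> c"
    using nat_pow_Suc2[OF c, of n] by simp
  have "(c \<otimes> a) \<otimes> ?z = ?z \<otimes> (c \<otimes> a)"
    unfolding eq using nat_pow_Suc2[of "c \<otimes> a" k] c a by simp
  moreover have "c \<otimes> (?z \<otimes> a) = (c \<otimes> ?z) \<otimes> a"
    using c a by (simp add: m_assoc)
  moreover have "\<dots> = ?z \<otimes> (c \<otimes> a)"
    unfolding cz using c a by (simp add: m_assoc)
  ultimately have "c \<otimes> (?z \<otimes> a) = c \<otimes> (a \<otimes> ?z)"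
    using c a by (simp add: m_assoc)
  then show "?z \<otimes> a = a \<otimes> ?z" using c a by simp
qed (use c a in auto)

lemma conj_pow_comm:
  assumes c: "c \<in> carrier G" and a: "a \<in> carrier G" and eq: "c [^] n = (c \<otimes> a) [^] (k :: nat)"
    and comm: "\<And>i. 2 \<le> i \<Longrightarrow> 2 * i \<le> n \<Longrightarrow> a \<otimes> conj_pow c a i = conj_pow c a i \<otimes> a"
    and ij: "i + 1 < j" "j + 1 < n"
  shows "conj_pow c a i \<otimes> conj_pow c a j = conj_pow c a j \<otimes> conj_pow c a i"
proof -
  have *: "a \<otimes> conj_pow c a d = conj_pow c a d \<otimes> a" if d: "2 \<le> d" "d + 2 \<le> n" for d
  proof (cases "2 * d \<le> n")
    case True
    then show ?thesis using comm d by simp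
  next
    case False
    \<comment> \<open>The complementary distance satisfies \<open>2 \<le> ?e\<close> and
      \<open>2 * ?e \<le> n\<close>. Conjugation by \<open>c [^] d\<close> sends \<open>a\<close> to
      \<open>conj_pow c a d\<close> and, by periodicity, \<open>conj_pow c a ?e\<close> to
      \<open>a\<close>.\<close>
    let ?e = "n - d"
    have "a \<otimes> conj_pow c a ?e = conj_pow c a ?e \<otimes> a"
      using False d by (intro comm) auto
    then have "conj_pow c (a \<otimes> conj_pow c a ?e) d = conj_pow c (conj_pow c a ?e \<otimes> a) d"
      by simp
    moreover have "conj_pow c (conj_pow c a ?e) d = a"
      using conj_pow_add[OF c a, of d ?e] conj_pow_period[OF c a eq] d by simp
    ultimately show ?thesis using c a by (simp add: conj_pow_mult)
  qed
  \<comment> \<open>Conjugation by \<open>c [^] i\<close> carries the indices \<open>0, d\<close> to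
    \<open>i, j\<close>.\<close>
  define d where "d = j - i"
  have "a \<otimes> conj_pow c a d = conj_pow c a d \<otimes> a"
    using ij by (intro *) (auto simp: d_def)
  then have "conj_pow c (a \<otimes> conj_pow c a d) i = conj_pow c (conj_pow c a d \<otimes> a) i"
    by simp
  moreover have "conj_pow c a j = conj_pow c (conj_pow c a d) i"
    using conj_pow_add[OF c a, of i d] ij by (simp add: d_def)
  ultimately show ?thesis using c a by (simp add: conj_pow_mult)
qed

text \<open>Both sides of \<open>\<sigma> \<sigma>\<^sub>1 = \<sigma>\<^sub>2 \<sigma>\<close> contain the factor \<open>\<sigma>\<^sub>3 \<dots> \<sigma>\<^sub>n\<^sub>-\<^sub>1\<close>, which commutes with \<open>\<sigma>\<^sub>1\<close>;
  cancelling it leaves the braid relation.\<close>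

lemma conj_pow_braid:
  assumes c: "c \<in> carrier G" and a: "a \<in> carrier G" and eq: "c [^] n = (c \<otimes> a) [^] (n - 1)"
    and comm: "\<And>i. 2 \<le> i \<Longrightarrow> 2 * i \<le> n \<Longrightarrow> a \<otimes> conj_pow c a i = conj_pow c a i \<otimes> a"
    and n: "3 \<le> n"
  defines "x \<equiv> conj_pow c a"
  shows "x i \<otimes> x (i + 1) \<otimes> x i = x (i + 1) \<otimes> x i \<otimes> x (i + 1)"
proof -
  \<comment> \<open>This splits off the first two of the \<open>n - 1\<close> factors of
    \<open>c\<close>; the remaining \<open>m\<close> may be none.\<close>
  obtain m where m: "n = Suc (Suc (Suc m))"
    using n by (auto dest!: le_Suc_ex simp: numeral_3_eq_3)
  let ?r = "run (\<lambda>i. x (Suc (Suc i))) m"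
  have x: "x i \<in> carrier G" for i using c a by (simp add: x_def)
  have x0: "x 0 = a" using a by (simp add: x_def)
  have "c = run x (Suc (Suc m))"
    using eq pow_eq_iff_run[OF c a, of "Suc (Suc m)"] by (simp add: m x_def)
  also have "\<dots> = x 0 \<otimes> (x 1 \<otimes> ?r)"
    using x by (simp only: run_Suc_left One_nat_def)
  finally have c_eq: "c = a \<otimes> (x 1 \<otimes> ?r)" using x0 by simp
  \<comment> \<open>The indices in \<open>?r\<close> run from 2 to \<open>n - 2\<close>, exactly the
    range in which \<open>conj_pow_comm\<close> applies to index 0.\<close>
  have "a \<otimes> ?r = ?r \<otimes> a"
    using conj_pow_comm[OF c a eq comm, of 0] x a
    by (intro commute_run) (auto simp: m x_def)
  then have "a \<otimes> x 1 \<otimes> a \<otimes> ?r = c \<otimes> a"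
    using c_eq x a by (simp add: m_assoc)
  also have "\<dots> = x 1 \<otimes> c"
    using conj_pow_commute[OF c a, of 1] c by (simp add: x_def)
  also have "\<dots> = x 1 \<otimes> a \<otimes> x 1 \<otimes> ?r"
    using c_eq x a by (simp add: m_assoc)
  finally have "a \<otimes> x 1 \<otimes> a = x 1 \<otimes> a \<otimes> x 1" using x a by simp
  \<comment> \<open>Conjugation by \<open>c [^] i\<close> carries the relation from index 0 to index
    \<open>i\<close>.\<close>
  then have "conj_pow c (a \<otimes> x 1 \<otimes> a) i = conj_pow c (x 1 \<otimes> a \<otimes> x 1) i"
    by simp
  moreover have "conj_pow c (x 1) i = x (i + 1)" by (simp only: x_def conj_pow_add[OF c a])
  ultimately show ?thesis using c a x by (simp add: conj_pow_mult flip: x_def)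
qed

end

section \<open>Translation between the two sets of generators\<close>

definition sigma_pow_word :: "nat \<Rightarrow> gen3 word" where
  "sigma_pow_word i = wpow (gen S) i @ gen S1 @ wpow (winv (gen S)) i"

text \<open>The exponent is one less than the index of the generator. Truncated subtraction gives
  \<open>Sigma_gen 0\<close>, which lies outside \<open>B_gens n\<close>, the word of
  \<open>Sigma_gen 1\<close>.\<close>

primrec B_gen_word :: "B_gen \<Rightarrow> gen3 word" where
  "B_gen_word (Sigma_gen i) = sigma_pow_word (i - 1)"
| "B_gen_word Tau_gen = gen T"

lemma B_gens_simps [simp]:
  "Sigma_gen i \<in> B_gens n \<longleftrightarrow> 1 \<le> i \<and> i \<le> n - 1" "Tau_gen \<in> B_gens n"
  by (auto simp: B_gens_def)

lemma words_gen3 [simp]: "w \<in> words {S1, S, T}"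
proof -
  have "x \<in> {S1, S, T}" for x by (cases x) auto
  then show ?thesis by (auto simp: words_def)
qed

lemma sigma_word_in_words: "m \<le> n \<Longrightarrow> sigma_word m \<in> words (B_gens n)"
  by (fastforce simp: sigma_word_def words_def gen_def)

lemma gen3_word_in_words: "2 \<le> n \<Longrightarrow> gen3_word n x \<in> words (B_gens n)"
  by (cases x) (auto simp: sigma_word_in_words)

lemma B_rels_in_words: "2 \<le> n \<Longrightarrow> B_rels n \<subseteq> words (B_gens n) \<times> words (B_gens n)"
  by (auto simp: B_rels_def Let_def)

lemma B_square_rels_in_words: "B_square_rels n \<subseteq> words (B_gens n) \<times> words (B_gens n)"
  by (auto simp: B_square_rels_def)

context group
begin

text \<open>\<open>sigma_word (Suc m)\<close> has the \<open>m\<close> letters with indices 1 to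
  \<open>m\<close>, while \<open>run\<close> counts from 0.\<close>

lemma eval_sigma_word:
  assumes f: "f \<in> B_gens n \<rightarrow> carrier G" and m: "m < n"
  shows "eval_word G f (sigma_word (Suc m)) = run (\<lambda>i. f (Sigma_gen (Suc i))) m"
  using m
proof (induction m)
  case 0
  then show ?case by (simp add: sigma_word_def)
next
  case (Suc m)
  have "sigma_word (Suc (Suc m)) = sigma_word (Suc m) @ gen (Sigma_gen (Suc m))"
    by (simp add: sigma_word_def)
  then show ?case
    using Suc f by (simp add: eval_word_append sigma_word_in_words eval_word_gen)
qed

lemma eval_sigma_pow_word:
  fixes f :: "gen3 \<Rightarrow> 'a"
  assumes "f \<in> {S1, S, T} \<rightarrow> carrier G"
  shows "eval_word G f (sigma_pow_word i) = conj_pow (f S) (f S1) i"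
proof -
  have "f S1 \<in> carrier G" "f S \<in> carrier G" using assms by auto
  then show ?thesis
    by (simp add: sigma_pow_word_def conj_pow_def eval_word_append[OF assms] m_assoc
        eval_word_wpow[OF assms] eval_word_winv[OF assms] eval_word_gen[OF assms] nat_pow_inv)
qed

text \<open>Evaluates all relations once, so that later arguments concern only the elements
  \<open>a\<close>, \<open>c\<close>, \<open>t\<close>.\<close>

lemma satisfies_few_rels_iff:
  assumes f: "f \<in> {S1, S, T} \<rightarrow> carrier G"
  defines "a \<equiv> f S1" and "c \<equiv> f S" and "t \<equiv> f T"
  shows "satisfies G f (few_rels n) \<longleftrightarrow>
    (\<forall>i. 2 \<le> i \<and> 2 * i \<le> n \<longrightarrow> a \<otimes> conj_pow c a i = conj_pow c a i \<otimes> a) \<and>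
    c [^] n = (c \<otimes> a) [^] (n - 1) \<and>
    (\<forall>i. 1 \<le> i \<and> i \<le> n - 2 \<longrightarrow> t \<otimes> conj_pow c a i = conj_pow c a i \<otimes> t) \<and>
    t \<otimes> (a \<otimes> (t \<otimes> a)) = a \<otimes> (t \<otimes> (a \<otimes> t))"
proof -
  have s: "wpow (gen S) i @ gen S1 @ wpow (winv (gen S)) i = sigma_pow_word i" for i
    by (simp add: sigma_pow_word_def)
  have ev: "eval_word G f (u @ v) = eval_word G f u \<otimes> eval_word G f v" for u v
    using eval_word_append[OF f] by simp
  show ?thesis
    unfolding few_rels_def Let_def s satisfies_Un satisfies_Collect
    by (auto simp: ev eval_sigma_pow_word[OF f] eval_word_wpow[OF f] eval_word_gen[OF f] assms(2-4))
qed

lemma satisfies_B_rels_iff: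
  assumes f: "f \<in> B_gens n \<rightarrow> carrier G" and n: "2 \<le> n"
  defines "y \<equiv> \<lambda>i. f (Sigma_gen (Suc i))" and "t \<equiv> f Tau_gen"
  shows "satisfies G f (B_rels n) \<longleftrightarrow>
    (\<forall>i j. i + 1 < j \<and> j < n - 1 \<longrightarrow> y i \<otimes> y j = y j \<otimes> y i) \<and>
    (\<forall>i. i + 1 < n - 1 \<longrightarrow> y i \<otimes> y (i + 1) \<otimes> y i = y (i + 1) \<otimes> y i \<otimes> y (i + 1)) \<and>
    (\<forall>i. 1 \<le> i \<and> i \<le> n - 2 \<longrightarrow> t \<otimes> y i = y i \<otimes> t) \<and>
    t \<otimes> (y 0 \<otimes> (t \<otimes> y 0)) = y 0 \<otimes> (t \<otimes> (y 0 \<otimes> t))"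
proof -
  have y: "y i \<in> carrier G" if "i < n - 1" for i
    using f that by (auto simp: y_def)
  have eval_gen: "eval_word G f (gen x) = f x" if "x \<in> B_gens n" for x
    using that by (rule eval_word_gen[OF f])
  have ev: "eval_word G f (gen x @ v) = f x \<otimes> eval_word G f v"
    if "x \<in> B_gens n" "v \<in> words (B_gens n)" for x v
    using that eval_word_append[OF f, of "gen x" v] by (simp add: eval_gen)
  have 1: "(\<forall>i j. i \<in> {1..n - 1} \<and> j \<in> {1..n - 1} \<and> 1 < \<bar>int i - int j\<bar> \<longrightarrow>
      eval_word G f (gen (Sigma_gen i) @ gen (Sigma_gen j)) =
      eval_word G f (gen (Sigma_gen j) @ gen (Sigma_gen i))) \<longleftrightarrow>
    (\<forall>i j. i + 1 < j \<and> j < n - 1 \<longrightarrow> y i \<otimes> y j = y j \<otimes> y i)" (is "?L \<longleftrightarrow> ?R")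
  proof
    assume L: ?L
    show ?R
    proof (intro allI impI)
      fix i j assume "i + 1 < j \<and> j < n - 1"
      then show "y i \<otimes> y j = y j \<otimes> y i"
        using L[rule_format, of "Suc i" "Suc j"] by (simp add: ev eval_gen y_def)
    qed
  next
    assume R: ?R
    show ?L
    proof (intro allI impI)
      \<comment> \<open>The equation is symmetric in the two indices, so the ordered case of
        \<open>?R\<close> covers both signs of the difference.\<close>
      fix i j assume ij: "i \<in> {1..n - 1} \<and> j \<in> {1..n - 1} \<and> 1 < \<bar>int i - int j\<bar>"
      define i' j' where "i' = i - 1" and "j' = j - 1"
      have ij': "i = Suc i'" "j = Suc j'" using ij by (auto simp: i'_def j'_def)
      have "i' + 1 < j' \<or> j' + 1 < i'" using ij by (auto simp: ij')
      moreover have "i' < n - 1" "j' < n - 1" using ij by (auto simp: ij')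
      ultimately have "y i' \<otimes> y j' = y j' \<otimes> y i'" using R by metis
      then show "eval_word G f (gen (Sigma_gen i) @ gen (Sigma_gen j)) =
          eval_word G f (gen (Sigma_gen j) @ gen (Sigma_gen i))"
        using ij by (simp add: ev eval_gen y_def ij')
    qed
  qed
  have shift: "(\<forall>i. 1 \<le> i \<and> P i \<longrightarrow> Q i) \<longleftrightarrow> (\<forall>i. P (Suc i) \<longrightarrow> Q (Suc i))" for P Q
  proof (intro iffI allI impI)
    fix i assume "\<forall>i. P (Suc i) \<longrightarrow> Q (Suc i)" "1 \<le> i \<and> P i"
    then show "Q i" by (cases i) auto
  qed auto
  have 2: "(\<forall>i. 1 \<le> i \<and> i + 1 \<le> n - 1 \<longrightarrow>
      eval_word G f (gen (Sigma_gen i) @ gen (Sigma_gen (i + 1)) @ gen (Sigma_gen i)) =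
      eval_word G f (gen (Sigma_gen (i + 1)) @ gen (Sigma_gen i) @ gen (Sigma_gen (i + 1)))) \<longleftrightarrow>
    (\<forall>i. i + 1 < n - 1 \<longrightarrow> y i \<otimes> y (i + 1) \<otimes> y i = y (i + 1) \<otimes> y i \<otimes> y (i + 1))"
    unfolding shift
    by (intro all_cong1 imp_cong) (auto simp: ev eval_gen m_assoc y[unfolded y_def] y_def)
  have 3: "(\<forall>i. 2 \<le> i \<and> i \<le> n - 1 \<longrightarrow>
      eval_word G f (gen Tau_gen @ gen (Sigma_gen i)) =
      eval_word G f (gen (Sigma_gen i) @ gen Tau_gen)) \<longleftrightarrow>
    (\<forall>i. 1 \<le> i \<and> i \<le> n - 2 \<longrightarrow> t \<otimes> y i = y i \<otimes> t)" (is "?L \<longleftrightarrow> ?R")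
  proof -
    \<comment> \<open>The conjunct \<open>1 \<le> i\<close>, implied by \<open>2 \<le> i\<close>,
      gives the formula the shape that \<open>shift\<close> rewrites.\<close>
    have "?L \<longleftrightarrow> (\<forall>i. 1 \<le> i \<and> 2 \<le> i \<and> i \<le> n - 1 \<longrightarrow>
      eval_word G f (gen Tau_gen @ gen (Sigma_gen i)) =
      eval_word G f (gen (Sigma_gen i) @ gen Tau_gen))"
      by auto
    also have "\<dots> \<longleftrightarrow> ?R"
      using n by (subst shift, intro all_cong1 imp_cong) (auto simp: ev eval_gen y_def t_def)
    finally show ?thesis .
  qed
  show ?thesis
    unfolding B_rels_def Let_def satisfies_Un satisfies_Collect 1 2 3
    using n by (simp add: ev eval_gen y_def t_def)
qed

text \<open>From the braid group to three generators: once \<open>conj_pow (g S) (g S1) i\<close> is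
  identified with \<open>y i\<close>, the relations become known ones, and the second claim says
  that the translations cancel.\<close>

lemma satisfies_few_rels:
  assumes f: "f \<in> B_gens n \<rightarrow> carrier G" and n: "2 \<le> n"
    and B: "satisfies G f (B_rels n)"
  defines "g \<equiv> \<lambda>x. eval_word G f (gen3_word n x)"
  shows "satisfies G g (few_rels n)"
    and "\<And>x. x \<in> B_gens n \<Longrightarrow> eval_word G g (B_gen_word x) = f x"
proof -
  define y t where "y i = f (Sigma_gen (Suc i))" and "t = f Tau_gen" for i
  have y: "y i \<in> carrier G" if "i < n - 1" for i
    using f that by (auto simp: y_def)
  note B' = B[unfolded satisfies_B_rels_iff[OF f n], folded y_def t_def]
  have g: "g \<in> {S1, S, T} \<rightarrow> carrier G"
    using f n by (auto simp: g_def gen3_word_in_words simp del: gen3_word.simps)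
  have gS1: "g S1 = y 0" and gT: "g T = t"
    using n eval_word_gen[OF f] by (auto simp: g_def y_def t_def)
  have gS: "g S = run y (n - 1)"
    using n eval_sigma_word[OF f, of "n - 1"] by (simp add: g_def y_def[abs_def])
  have x: "conj_pow (g S) (g S1) i = y i" if "i < n - 1" for i
    unfolding gS gS1 using B' y that by (intro conj_pow_run_braid) auto
  have "run y (n - 1) = run (conj_pow (g S) (g S1)) (n - 1)"
    by (rule run_cong) (rule x[symmetric])
  then have "g S = run (conj_pow (g S) (g S1)) (n - 1)"
    by (rule HOL.trans[OF gS])
  then have "g S [^] n = (g S \<otimes> g S1) [^] (n - 1)"
    using pow_eq_iff_run[of "g S" "g S1" "n - 1"] g n by simp
  moreover have "y 0 \<otimes> y i = y i \<otimes> y 0" if "2 \<le> i" "2 * i \<le> n" for i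
  proof -
    \<comment> \<open>From \<open>2 \<le> i\<close> and \<open>2 * i \<le> n\<close> follows
      \<open>i \<le> n - 2\<close>, so \<open>y i\<close> is one of the generators.\<close>
    have "0 + 1 < i \<and> i < n - 1" using that by auto
    then show ?thesis using B' by blast
  qed
  ultimately show "satisfies G g (few_rels n)"
    unfolding satisfies_few_rels_iff[OF g] using B' n by (auto simp: x gT) (auto simp: gS1)
  fix z assume z: "z \<in> B_gens n"
  show "eval_word G g (B_gen_word z) = f z"
  proof (cases z)
    case (Sigma_gen i)
    then have "1 \<le> i" "i - 1 < n - 1" using z by auto
    then show ?thesis
      using x[of "i - 1"] eval_sigma_pow_word[OF g] by (simp add: Sigma_gen y_def)
  next
    case Tau_gen
    then show ?thesis using eval_word_gen[OF g, of T] by (simp add: gT t_def)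
  qed
qed

text \<open>The converse translation: the relations among the \<open>\<sigma>\<^sub>i\<close> are
  \<open>conj_pow_comm\<close> and \<open>conj_pow_braid\<close>, and those with
  \<open>\<tau>\<close> are given directly.\<close>

lemma satisfies_B_rels:
  assumes f: "f \<in> {S1, S, T} \<rightarrow> carrier G" and n: "2 \<le> n"
    and few: "satisfies G f (few_rels n)"
  defines "g \<equiv> \<lambda>y. eval_word G f (B_gen_word y)"
  shows "satisfies G g (B_rels n)"
    and "eval_word G g (gen3_word n x) = f x"
proof -
  have a: "f S1 \<in> carrier G" and c: "f S \<in> carrier G" using f by auto
  note few' = few[unfolded satisfies_few_rels_iff[OF f]]
  have comm: "f S1 \<otimes> conj_pow (f S) (f S1) i = conj_pow (f S) (f S1) i \<otimes> f S1"
    if "2 \<le> i" "2 * i \<le> n" for i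
    using few' that by blast
  have eq: "f S [^] n = (f S \<otimes> f S1) [^] (n - 1)"
    using few' by blast
  have tau: "f T \<otimes> conj_pow (f S) (f S1) i = conj_pow (f S) (f S1) i \<otimes> f T"
    if "1 \<le> i" "i \<le> n - 2" for i
    using few' that by blast
  have tau_S1: "f T \<otimes> (f S1 \<otimes> (f T \<otimes> f S1)) = f S1 \<otimes> (f T \<otimes> (f S1 \<otimes> f T))"
    using few' by blast
  have g: "g \<in> B_gens n \<rightarrow> carrier G"
    by (simp add: g_def eval_word_closed[OF f])
  have g_sigma: "g (Sigma_gen (Suc i)) = conj_pow (f S) (f S1) i" for i
    by (simp add: g_def eval_sigma_pow_word[OF f])
  have g_tau: "g Tau_gen = f T"
    using eval_word_gen[OF f] by (simp add: g_def)
  show "satisfies G g (B_rels n)"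
    unfolding satisfies_B_rels_iff[OF g n] g_sigma g_tau
  proof (intro conjI allI impI; (elim conjE)?)
    fix i j assume "i + 1 < j" "j < n - 1"
    then show "conj_pow (f S) (f S1) i \<otimes> conj_pow (f S) (f S1) j =
        conj_pow (f S) (f S1) j \<otimes> conj_pow (f S) (f S1) i"
      by (intro conj_pow_comm[OF c a eq comm]) auto
  next
    \<comment> \<open>Such an index exists only for \<open>3 \<le> n\<close>, as
      \<open>conj_pow_braid\<close> requires.\<close>
    fix i assume "i + 1 < n - 1"
    then show "conj_pow (f S) (f S1) i \<otimes> conj_pow (f S) (f S1) (i + 1) \<otimes> conj_pow (f S) (f S1) i =
        conj_pow (f S) (f S1) (i + 1) \<otimes> conj_pow (f S) (f S1) i \<otimes> conj_pow (f S) (f S1) (i + 1)"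
      by (intro conj_pow_braid[OF c a eq comm]) auto
  qed (use tau tau_S1 a in auto)
  have "f S = run (conj_pow (f S) (f S1)) (n - 1)"
    using pow_eq_iff_run[OF c a, of "n - 1"] eq n by simp
  then have "eval_word G g (sigma_word n) = f S"
    using eval_sigma_word[OF g, of "n - 1"] n by (simp add: g_sigma)
  then show "eval_word G g (gen3_word n x) = f x"
    using n g_sigma[of 0] a by (cases x) (simp_all add: eval_word_gen[OF g] g_tau)
qed

end

text \<open>The additional relations \<open>Q\<close> and \<open>R\<close> are parameters so that
  the braid group and the Coxeter group are two instances of one argument.\<close>

lemma has_presentation_few_rels:
  assumes n: "2 \<le> n"
    and Q: "Q \<subseteq> words (B_gens n) \<times> words (B_gens n)"
    and sat_R: "satisfies (presented_group (B_gens n) (B_rels n \<union> Q))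
      (\<lambda>x. wclass (B_gens n) (B_rels n \<union> Q) (gen3_word n x)) R"
    and sat_Q: "satisfies (presented_group {S1, S, T} (few_rels n \<union> R))
      (\<lambda>y. wclass {S1, S, T} (few_rels n \<union> R) (B_gen_word y)) Q"
  shows "has_presentation (presented_group (B_gens n) (B_rels n \<union> Q)) {S1, S, T} (few_rels n \<union> R)
    (\<lambda>x. wclass (B_gens n) (B_rels n \<union> Q) (gen3_word n x))"
proof -
  let ?X = "{S1, S, T}" and ?Y = "B_gens n" and ?R = "few_rels n \<union> R" and ?Q = "B_rels n \<union> Q"
  let ?G = "presented_group ?Y ?Q" and ?H = "presented_group ?X ?R"
  let ?f = "\<lambda>y. wclass ?Y ?Q (gen y)" and ?k = "\<lambda>x. wclass ?X ?R (gen x)"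
  interpret G: group ?G by (rule group_presented_group)
  interpret H: group ?H by (rule group_presented_group)
  have R_words: "?R \<subseteq> words ?X \<times> words ?X" by auto
  have Q_words: "?Q \<subseteq> words ?Y \<times> words ?Y" using Q B_rels_in_words[OF n] by auto
  have f: "?f \<in> ?Y \<rightarrow> carrier ?G" and k: "?k \<in> ?X \<rightarrow> carrier ?H"
    by (auto simp: carrier_presented_group simp del: words_simps(4)) auto
  have B: "satisfies ?G ?f (B_rels n)" and few: "satisfies ?H ?k (few_rels n)"
    using satisfies_presented_group[OF Q_words] satisfies_presented_group[OF R_words]
    by (simp_all only: satisfies_Un)
  have g: "eval_word ?G ?f (gen3_word n x) = wclass ?Y ?Q (gen3_word n x)" for x
    by (intro eval_word_presented_group gen3_word_in_words n)
  have h: "eval_word ?H ?k (B_gen_word y) = wclass ?X ?R (B_gen_word y)" for y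
    by (intro eval_word_presented_group words_gen3)
  note G = G.satisfies_few_rels[OF f n B, unfolded g]
  note H = H.satisfies_B_rels[OF k n few, unfolded h]
  show ?thesis
    using G H sat_R sat_Q
    by (intro has_presentation_change_generators[where h = B_gen_word, OF R_words Q_words])
      (simp_all only: satisfies_Un gen3_word_in_words[OF n] words_gen3)
qed

section \<open>The square relations and the Coxeter group\<close>

lemma (in group) conj_pow_square:
  assumes "c \<in> carrier G" "a \<in> carrier G" "a \<otimes> a = \<one>"
  shows "conj_pow c a i \<otimes> conj_pow c a i = \<one>"
  using assms by (simp flip: conj_pow_mult) (simp add: conj_pow_def)

lemma (in group) satisfies_square_rels_iff:
  assumes f: "f \<in> X \<rightarrow> carrier G" and A: "A \<subseteq> X"
  shows "satisfies G f {(gen x @ gen x, []) | x. x \<in> A} \<longleftrightarrow> (\<forall>x\<in>A. f x \<otimes> f x = \<one>)"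
proof -
  have "eval_word G f (gen x @ gen x) = f x \<otimes> f x" if "x \<in> A" for x
    using that A by (auto simp: eval_word_append[OF f] eval_word_gen[OF f])
  then show ?thesis by (auto simp: satisfies_Collect)
qed

lemma (in group) satisfies_B_square_rels_iff:
  assumes "f \<in> B_gens n \<rightarrow> carrier G"
  shows "satisfies G f (B_square_rels n) \<longleftrightarrow> (\<forall>y\<in>B_gens n. f y \<otimes> f y = \<one>)"
  unfolding B_square_rels_def using assms by (rule satisfies_square_rels_iff) simp

lemma (in group) satisfies_few_square_rels_iff:
  assumes "f \<in> {S1, S, T} \<rightarrow> carrier G"
  shows "satisfies G f few_square_rels \<longleftrightarrow> f S1 \<otimes> f S1 = \<one> \<and> f T \<otimes> f T = \<one>"
proof -
  have "few_square_rels = {(gen x @ gen x, []) | x. x \<in> {S1, T}}"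
    by (auto simp: few_square_rels_def)
  then show ?thesis using satisfies_square_rels_iff[OF assms, of "{S1, T}"] by simp
qed

theorem mainTheorem4:
  fixes n :: nat
  assumes "n \<ge> 2"
  shows "has_presentation (Br_B n) {S1, S, T} (few_rels n)
           (\<lambda>x. wclass (B_gens n) (B_rels n) (gen3_word n x))
       \<and> has_presentation (Coxeter_B n) {S1, S, T} (few_rels n \<union> few_square_rels)
           (\<lambda>x. wclass (B_gens n) (B_rels n \<union> B_square_rels n) (gen3_word n x))"
proof
  show "has_presentation (Br_B n) {S1, S, T} (few_rels n)
      (\<lambda>x. wclass (B_gens n) (B_rels n) (gen3_word n x))"
    using has_presentation_few_rels[OF assms, of "{}" "{}"] by (simp add: Br_B_def satisfies_def)
next
  let ?X = "{S1, S, T}" and ?Y = "B_gens n"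
  let ?R = "few_rels n \<union> few_square_rels" and ?Q = "B_rels n \<union> B_square_rels n"
  let ?G = "presented_group ?Y ?Q" and ?H = "presented_group ?X ?R"
  let ?f = "\<lambda>y. wclass ?Y ?Q (gen y)" and ?k = "\<lambda>x. wclass ?X ?R (gen x)"
  interpret G: group ?G by (rule group_presented_group)
  interpret H: group ?H by (rule group_presented_group)
  have f: "?f \<in> ?Y \<rightarrow> carrier ?G" and k: "?k \<in> ?X \<rightarrow> carrier ?H"
    by (auto simp: carrier_presented_group)
  have fg: "(\<lambda>x. wclass ?Y ?Q (gen3_word n x)) \<in> ?X \<rightarrow> carrier ?G"
    by (intro Pi_I) (simp only: carrier_presented_group imageI gen3_word_in_words[OF assms])
  have kh: "(\<lambda>y. wclass ?X ?R (B_gen_word y)) \<in> ?Y \<rightarrow> carrier ?H"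
    by (auto simp: carrier_presented_group)
  show "has_presentation (Coxeter_B n) ?X ?R (\<lambda>x. wclass ?Y ?Q (gen3_word n x))"
    unfolding Coxeter_B_def
  proof (rule has_presentation_few_rels[OF assms B_square_rels_in_words])
    have "satisfies ?G ?f (B_square_rels n)"
      using satisfies_presented_group[of ?Q ?Y] B_rels_in_words[OF assms] B_square_rels_in_words
      by (simp add: satisfies_Un)
    then have "?f y \<otimes>\<^bsub>?G\<^esub> ?f y = \<one>\<^bsub>?G\<^esub>" if "y \<in> ?Y" for y
      using that unfolding G.satisfies_B_square_rels_iff[OF f] by blast
    \<comment> \<open>As \<open>n \<ge> 2\<close>, \<open>Sigma_gen 1\<close> belongs to
      \<open>B_gens n\<close>, so its square is among the relations.\<close>
    then show "satisfies ?G (\<lambda>x. wclass ?Y ?Q (gen3_word n x)) few_square_rels"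
      unfolding G.satisfies_few_square_rels_iff[OF fg] using assms by simp
    have "satisfies ?H ?k few_square_rels"
      using satisfies_presented_group[of ?R ?X] by (simp add: satisfies_Un subset_iff)
    then have sq: "?k S1 \<otimes>\<^bsub>?H\<^esub> ?k S1 = \<one>\<^bsub>?H\<^esub>" "?k T \<otimes>\<^bsub>?H\<^esub> ?k T = \<one>\<^bsub>?H\<^esub>"
      unfolding H.satisfies_few_square_rels_iff[OF k] by blast+
    have "wclass ?X ?R (B_gen_word y) \<otimes>\<^bsub>?H\<^esub> wclass ?X ?R (B_gen_word y) = \<one>\<^bsub>?H\<^esub>" for y
    proof (cases y)
      case (Sigma_gen i)
      \<comment> \<open>The class is a conjugate of that of \<open>S1\<close>, so its square is
        trivial too.\<close>
      have "wclass ?X ?R (B_gen_word y) = H.conj_pow (?k S) (?k S1) (i - 1)"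
        using H.eval_sigma_pow_word[OF k, of "i - 1"]
        by (simp add: Sigma_gen eval_word_presented_group)
      moreover have "?k S \<in> carrier ?H" "?k S1 \<in> carrier ?H" using k by auto
      ultimately show ?thesis using H.conj_pow_square sq by simp
    next
      case Tau_gen
      then show ?thesis using sq by simp
    qed
    then show "satisfies ?H (\<lambda>y. wclass ?X ?R (B_gen_word y)) (B_square_rels n)"
      unfolding H.satisfies_B_square_rels_iff[OF kh] by blast
  qed
qed

end
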